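(* Let $r_1=\frac{k}{n}$, $r_2=\frac{\ell}{k}$ and $p_{tol}$ be fixed. Assume $r_2\in\left[\frac{k}{n},1\right]$. Let $$C_0(k)=C_0(k;r_1,r_2,p_{tol})$$ be the largest $A$ such that $$\mathrm{pr}\left(\max_{1\leq i<j\leq A}|X_i\cap X_j|\geq k r_2\right)\leq p_{tol},$$ where the $X_i, X_j$ are independently and uniformly sampled $k$-subsets of a set of size $n$. Then $$C_0(k)\geq \sqrt{2p_{tol}}\; e^{k\left|r_1-r_2\right|^2}.$$
   Context: Here $n$ is the size of a dataset, $k$ is the size of the subsample drawn from it by each study (a $k$-subset is a subset with $k$ elements), $\ell$ is a threshold for the size of the pairwise intersections of the subsamples, $p_{tol}$ is the tolerated probability that some pairwise intersection has size at least $\ell=kr_2$, and $A$ is the number of subsamples drawn.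
   Formalization: The lower bound is proved with the integer part of the right-hand side, since C_0(k) is an integer and the unrounded bound fails (n=4, k=2, l=1, p_tol=0.6 gives C_0=1 < 1.095); also 0 ≤ p_tol < 1 is assumed, as no largest A exists for p_tol=1. *)

theory Defs
  imports "HOL-Probability.Probability"
begin

definition k_subsets :: "'a set \<Rightarrow> nat \<Rightarrow> 'a set set" where
  "k_subsets D k = {S. S \<subseteq> D \<and> card S = k}"

text \<open>
  The joint law of the independent uniform subsamples \<open>X 1, \<dots>, X A\<close>.
  The empty set is only the junk value of \<open>X i\<close> at indices outside \<open>{1..A}\<close>.
\<close>
definition subsamples :: "'a set \<Rightarrow> nat \<Rightarrow> nat \<Rightarrow> (nat \<Rightarrow> 'a set) pmf" where
  "subsamples D k A = Pi_pmf {1..A} {} (\<lambda>_. pmf_of_set (k_subsets D k))"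

text \<open>
  Inserting \<open>0\<close> has an effect only if there is no pair (\<open>A \<le> 1\<close>), where it fixes the
  maximum over the empty family to be \<open>0\<close>.
\<close>
definition max_overlap :: "nat \<Rightarrow> (nat \<Rightarrow> 'a set) \<Rightarrow> nat" where
  "max_overlap A X = Max (insert 0 {card (X i \<inter> X j) | i j. 1 \<le> i \<and> i < j \<and> j \<le> A})"

definition overlap_prob :: "'a set \<Rightarrow> nat \<Rightarrow> real \<Rightarrow> nat \<Rightarrow> real" where
  "overlap_prob D k r\<^sub>2 A =
     measure_pmf.prob (subsamples D k A) {X. real (max_overlap A X) \<ge> real k * r\<^sub>2}"

text \<open>
  The ratio \<open>r\<^sub>1 = k / n\<close> enters through the size \<open>n\<close> of the dataset \<open>D\<close>.
\<close>
definition C\<^sub>0 :: "'a set \<Rightarrow> nat \<Rightarrow> real \<Rightarrow> real \<Rightarrow> nat" where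
  "C\<^sub>0 D k r\<^sub>2 p_tol = (GREATEST A. overlap_prob D k r\<^sub>2 A \<le> p_tol)"

lemma finite_overlaps: "finite {card (X i \<inter> X j) | i j. 1 \<le> i \<and> i < j \<and> j \<le> (A::nat)}"
proof -
  have "{card (X i \<inter> X j) | i j. 1 \<le> i \<and> i < j \<and> j \<le> A}
      \<subseteq> (\<lambda>(i, j). card (X i \<inter> X j)) ` ({..A} \<times> {..A})"
    by force
  then show ?thesis by (rule finite_subset) simp
qed

lemma overlap_prob_eq_1:
  assumes "finite D" "k \<le> card D" "r\<^sub>2 \<le> 1" "A > card (k_subsets D k)"
  shows "overlap_prob D k r\<^sub>2 A = 1"
proof -
  have fin: "finite (k_subsets D k)"
    unfolding k_subsets_def using assms(1) by simp
  have ne: "k_subsets D k \<noteq> {}"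
    unfolding k_subsets_def using obtain_subset_with_card_n[OF assms(2)] by blast
  have "real (max_overlap A X) \<ge> real k * r\<^sub>2" if "X \<in> set_pmf (subsamples D k A)" for X
  proof -
    have X: "X i \<in> k_subsets D k" if "i \<in> {1..A}" for i
      using \<open>X \<in> set_pmf _\<close> that set_Pi_pmf[of "{1..A}" "{}" "\<lambda>_. pmf_of_set (k_subsets D k)"]
        set_pmf_of_set[OF ne fin]
      unfolding subsamples_def by (auto simp: PiE_dflt_def)
    then have "card (X ` {1..A}) \<le> card (k_subsets D k)"
      by (intro card_mono fin) auto
    then have "\<not> inj_on X {1..A}"
      using assms(4) card_image[of X "{1..A}"] by auto
    then obtain i j where ij: "i \<in> {1..A}" "j \<in> {1..A}" "i < j" "X i = X j"
      unfolding inj_on_def by (metis linorder_neqE_nat)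
    have k: "k = card (X i \<inter> X j)"
      using X[OF ij(1)] ij(4) by (simp add: k_subsets_def)
    have "1 \<le> i \<and> i < j \<and> j \<le> A"
      using ij(1-3) by simp
    with k have "k \<in> {card (X i \<inter> X j) | i j. 1 \<le> i \<and> i < j \<and> j \<le> A}"
      by blast
    then have "k \<le> max_overlap A X"
      unfolding max_overlap_def by (intro Max_ge[OF finite.insertI[OF finite_overlaps]] insertI2)
    moreover have "real k * r\<^sub>2 \<le> real k"
      using assms(3) by (simp add: mult_left_le)
    ultimately show ?thesis by linarith
  qed
  then have "AE X in subsamples D k A. X \<in> {X. real (max_overlap A X) \<ge> real k * r\<^sub>2}"
    by (simp add: AE_measure_pmf_iff)
  then show ?thesis
    unfolding overlap_prob_def by (subst measure_pmf.prob_eq_1) auto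
qed

text \<open>For \<open>0 \<le> p_tol < 1\<close> the largest \<open>A\<close> exists; for \<open>p_tol \<ge> 1\<close> every \<open>A\<close> would qualify.\<close>
lemma C\<^sub>0_greatest:
  assumes "finite D" "0 < k" "k \<le> card D" "0 < r\<^sub>2" "r\<^sub>2 \<le> 1" "0 \<le> p_tol" "p_tol < 1"
  shows "overlap_prob D k r\<^sub>2 (C\<^sub>0 D k r\<^sub>2 p_tol) \<le> p_tol"
    and "overlap_prob D k r\<^sub>2 A \<le> p_tol \<Longrightarrow> A \<le> C\<^sub>0 D k r\<^sub>2 p_tol"
proof -
  have "max_overlap 0 X = 0" for X :: "nat \<Rightarrow> 'a set"
    unfolding max_overlap_def by simp
  then have 0: "overlap_prob D k r\<^sub>2 0 \<le> p_tol"
    using assms unfolding overlap_prob_def by (simp add: not_le)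
  have bound: "B \<le> card (k_subsets D k)" if "overlap_prob D k r\<^sub>2 B \<le> p_tol" for B
    using overlap_prob_eq_1[of D k r\<^sub>2 B] assms that by force
  show "overlap_prob D k r\<^sub>2 (C\<^sub>0 D k r\<^sub>2 p_tol) \<le> p_tol"
    unfolding C\<^sub>0_def by (rule GreatestI_nat[where P = "\<lambda>A. overlap_prob D k r\<^sub>2 A \<le> p_tol", OF 0 bound])
  show "A \<le> C\<^sub>0 D k r\<^sub>2 p_tol" if "overlap_prob D k r\<^sub>2 A \<le> p_tol"
    unfolding C\<^sub>0_def by (rule Greatest_le_nat[where P = "\<lambda>A. overlap_prob D k r\<^sub>2 A \<le> p_tol", OF that bound])
qed

end

theory Submission imports Defs begin

text \<open>
  By the union bound, \<open>overlap_prob\<close> is at most \<open>A\<^sup>2 / 2\<close> times the largest probability, over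
  fixed \<open>k\<close>-subsets \<open>T\<close>, that \<open>|T \<inter> X| \<ge> k r\<^sub>2\<close>. The hypergeometric variable \<open>|T \<inter> X|\<close> has
  a moment generating function dominated by that of the binomial distribution with
  parameters \<open>k\<close> and \<open>r\<^sub>1 = k / n\<close>: expand \<open>(1 + x)\<^bsup>|T \<inter> X|\<^esup>\<close> over the subsets \<open>S\<close> of \<open>T \<inter> X\<close> and
  use that \<open>S \<subseteq> X\<close> has probability at most \<open>r\<^sub>1\<^bsup>|S|\<^esup>\<close>. Hoeffding's lemma and Markov's
  inequality then give the tail bound \<open>exp (- 2 k (r\<^sub>2 - r\<^sub>1)\<^sup>2)\<close>.
\<close>

section \<open>Counting the \<open>k\<close>-subsets that contain a given set\<close>

lemma finite_k_subsets: "finite D \<Longrightarrow> finite (k_subsets D k)"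
  by (simp add: k_subsets_def)

lemma k_subsets_nonempty: "k \<le> card D \<Longrightarrow> k_subsets D k \<noteq> {}"
  unfolding k_subsets_def using obtain_subset_with_card_n by blast

lemma card_k_subsets: "finite D \<Longrightarrow> card (k_subsets D k) = card D choose k"
  unfolding k_subsets_def by (rule n_subsets)

text \<open>Removing \<open>S\<close> is a bijection onto the subsets of \<open>D - S\<close> with
  \<open>k - card S\<close> elements.\<close>

lemma card_k_subsets_supset:
  assumes "finite D" "S \<subseteq> D" "card S \<le> k"
  shows "card {X \<in> k_subsets D k. S \<subseteq> X} = (card D - card S) choose (k - card S)"
proof -
  have fS: "finite S"
    using assms finite_subset by blast
  have "bij_betw (\<lambda>X. X - S) {X \<in> k_subsets D k. S \<subseteq> X} (k_subsets (D - S) (k - card S))"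
  proof (rule bij_betwI[where g = "\<lambda>Y. Y \<union> S"])
    show "(\<lambda>X. X - S) \<in> {X \<in> k_subsets D k. S \<subseteq> X} \<rightarrow> k_subsets (D - S) (k - card S)"
      using fS by (auto simp: k_subsets_def card_Diff_subset)
    show "(\<lambda>Y. Y \<union> S) \<in> k_subsets (D - S) (k - card S) \<rightarrow> {X \<in> k_subsets D k. S \<subseteq> X}"
    proof
      fix Y assume Y: "Y \<in> k_subsets (D - S) (k - card S)"
      then have "finite Y"
        using assms(1) by (auto simp: k_subsets_def intro: finite_subset)
      then have "card (Y \<union> S) = card Y + card S"
        using Y fS by (intro card_Un_disjoint) (auto simp: k_subsets_def)
      then show "Y \<union> S \<in> {X \<in> k_subsets D k. S \<subseteq> X}"
        using Y assms by (auto simp: k_subsets_def)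
    qed
  qed (auto simp: k_subsets_def)
  then have "card {X \<in> k_subsets D k. S \<subseteq> X} = card (D - S) choose (k - card S)"
    using assms(1) by (simp add: bij_betw_same_card card_k_subsets)
  then show ?thesis
    using assms fS by (simp add: card_Diff_subset)
qed

text \<open>Division-free form: the quotient of the two binomial coefficients is the product of
  \<open>(k - i) / (n - i)\<close> over \<open>i < j\<close>, and each factor is at most
  \<open>k / n\<close> because \<open>k \<le> n\<close>. The induction splits off one factor at a
  time.\<close>

lemma binomial_diff_diff_le:
  fixes n k j :: nat
  assumes "j \<le> k" "k \<le> n"
  shows "n ^ j * ((n - j) choose (k - j)) \<le> k ^ j * (n choose k)"
  using assms(1)
proof (induction j)
  case (Suc j)
  define B where "B = (n - j) choose (k - j)"
  define B' where "B' = (n - Suc j) choose (k - Suc j)"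
  have "(k - j) * B = (n - j) * B'"
    unfolding B_def B'_def using times_binomial_minus1_eq[of "k - j" "n - j"] Suc.prems by simp
  then have "(n - j) * (n * B') = n * (k - j) * B"
    by (metis mult.assoc mult.left_commute)
  \<comment> \<open>After expansion, \<open>n * (k - j) \<le> k * (n - j)\<close> is just
    \<open>k * j \<le> n * j\<close>.\<close>
  also have "\<dots> \<le> k * (n - j) * B"
    using assms Suc.prems by (intro mult_right_mono) (auto simp: diff_mult_distrib2 mult.commute diff_le_mono2)
  finally have "(n - j) * (n * B') \<le> (n - j) * (k * B)"
    by (simp add: mult_ac)
  then have step: "n * B' \<le> k * B"
    using assms Suc.prems by simp
  have "n ^ Suc j * B' = n ^ j * (n * B')"
    by simp
  also have "\<dots> \<le> n ^ j * (k * B)"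
    using step by (rule mult_left_mono) simp
  also have "\<dots> = k * (n ^ j * B)"
    by simp
  also have "\<dots> \<le> k * (k ^ j * (n choose k))"
    using Suc unfolding B_def by (intro mult_left_mono) auto
  finally show ?case
    unfolding B'_def by simp
qed simp

lemma card_k_subsets_supset_le:
  assumes "finite D" "S \<subseteq> D" "card S \<le> k" "k \<le> card D" "0 < k"
  shows "real (card {X \<in> k_subsets D k. S \<subseteq> X})
    \<le> (real k / real (card D)) ^ card S * real (card (k_subsets D k))"
proof -
  have "real (card D ^ card S * ((card D - card S) choose (k - card S)))
      \<le> real (k ^ card S * (card D choose k))"
    using binomial_diff_diff_le[OF assms(3,4)] by (simp only: of_nat_le_iff)
  then show ?thesis
    using assms by (simp add: card_k_subsets_supset card_k_subsets power_divide field_simps)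
qed

section \<open>Exponential moments and the tail of an intersection size\<close>

lemma one_plus_power_card:
  fixes x :: "'b :: comm_semiring_1"
  assumes "finite T"
  shows "(1 + x) ^ card T = (\<Sum>S\<in>Pow T. x ^ card S)"
  using prod_add[OF assms, of "\<lambda>_. x" "\<lambda>_. 1"] by (simp add: add.commute)

lemma sum_one_plus_power_card_inter_le:
  fixes x :: real
  assumes "finite D" "k \<le> card D" "0 < k" "T \<in> k_subsets D k" "0 \<le> x"
  shows "(\<Sum>X\<in>k_subsets D k. (1 + x) ^ card (T \<inter> X))
    \<le> (1 + real k / real (card D) * x) ^ k * real (card (k_subsets D k))"
proof -
  let ?K = "k_subsets D k" and ?p = "real k / real (card D)"
  have T: "T \<subseteq> D" "card T = k" "finite T"
    using assms finite_subset by (auto simp: k_subsets_def)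
  have "(\<Sum>X\<in>?K. (1 + x) ^ card (T \<inter> X)) = (\<Sum>X\<in>?K. \<Sum>S\<in>Pow (T \<inter> X). x ^ card S)"
    using T by (intro sum.cong one_plus_power_card) auto
  also have "\<dots> = (\<Sum>X\<in>?K. \<Sum>S\<in>{S \<in> Pow T. S \<subseteq> X}. x ^ card S)"
    by (intro sum.cong) auto
  \<comment> \<open>Double counting of the pairs \<open>S \<subseteq> T \<inter> X\<close> reduces
    the sum to the numbers of \<open>k\<close>-subsets above a fixed \<open>S\<close>.\<close>
  also have "\<dots> = (\<Sum>S\<in>Pow T. \<Sum>X\<in>{X \<in> ?K. S \<subseteq> X}. x ^ card S)"
    using T assms by (intro sum.swap_restrict finite_k_subsets) auto
  also have "\<dots> = (\<Sum>S\<in>Pow T. real (card {X \<in> ?K. S \<subseteq> X}) * x ^ card S)"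
    by simp
  also have "\<dots> \<le> (\<Sum>S\<in>Pow T. (?p ^ card S * real (card ?K)) * x ^ card S)"
    using T assms card_mono[OF \<open>finite T\<close>]
    by (intro sum_mono mult_right_mono card_k_subsets_supset_le) auto
  also have "\<dots> = (\<Sum>S\<in>Pow T. (?p * x) ^ card S) * real (card ?K)"
    by (simp only: sum_distrib_left sum_distrib_right power_mult_distrib mult_ac)
  also have "\<dots> = (1 + ?p * x) ^ k * real (card ?K)"
    using one_plus_power_card[OF T(3), of "?p * x"] T by simp
  finally show ?thesis .
qed

text \<open>Hoeffding's lemma in exponentiated form: for \<open>p \<le> 1\<close> the left side is
  the moment generating function at \<open>h\<close> of a Bernoulli variable with mean
  \<open>p\<close>.\<close>

lemma bernoulli_mgf_le:
  fixes h p :: real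
  assumes "0 \<le> h" "0 \<le> p"
  shows "1 + p * (exp h - 1) \<le> exp (h * p + h\<^sup>2 / 8)"
proof -
  have "0 < 1 + p * (exp h - 1)"
    using assms by (simp add: add_pos_nonneg)
  then have "1 + p * (exp h - 1) = exp (ln (1 + p * (exp h - 1)))"
    by simp
  also have "\<dots> \<le> exp (h * p + h\<^sup>2 / 8)"
    using Hoeffdings_lemma_aux[OF assms] by simp
  finally show ?thesis .
qed

lemma prob_inter_k_subset_ge:
  fixes r :: real
  assumes "finite D" "k \<le> card D" "0 < k" "T \<in> k_subsets D k"
    and r: "real k / real (card D) \<le> r"
  shows "measure_pmf.prob (pmf_of_set (k_subsets D k)) {X. real k * r \<le> real (card (T \<inter> X))}
    \<le> exp (- 2 * real k * (real k / real (card D) - r)\<^sup>2)"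
proof -
  let ?K = "k_subsets D k" and ?p = "real k / real (card D)"
  let ?E = "{X. real k * r \<le> real (card (T \<inter> X))}"
  \<comment> \<open>The minimiser of \<open>k (h p - h r + h\<^sup>2 / 8)\<close>, the exponent in the final estimate.\<close>
  define h where "h = 4 * (r - ?p)"
  have h: "0 \<le> h"
    using r by (simp add: h_def)
  have fK: "finite ?K" and nK: "?K \<noteq> {}"
    using assms finite_k_subsets k_subsets_nonempty by auto
  have K0: "0 < real (card ?K)"
    using fK nK by (simp add: card_gt_0_iff)
  \<comment> \<open>Markov's inequality for \<open>exp (h * card (T \<inter> X))\<close>, written
    with cardinalities since \<open>X\<close> is uniform on \<open>?K\<close>.\<close>
  have "real (card (?K \<inter> ?E)) * exp (h * (real k * r)) = (\<Sum>X\<in>?K \<inter> ?E. exp (h * (real k * r)))"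
    by simp
  also have "\<dots> \<le> (\<Sum>X\<in>?K \<inter> ?E. exp (h * real (card (T \<inter> X))))"
    using h by (intro sum_mono) (auto intro!: mult_left_mono)
  also have "\<dots> \<le> (\<Sum>X\<in>?K. exp (h * real (card (T \<inter> X))))"
    using fK by (intro sum_mono2) auto
  also have "\<dots> = (\<Sum>X\<in>?K. (1 + (exp h - 1)) ^ card (T \<inter> X))"
    by (simp add: exp_of_nat2_mult)
  also have "\<dots> \<le> (1 + ?p * (exp h - 1)) ^ k * real (card ?K)"
    using assms h by (intro sum_one_plus_power_card_inter_le) auto
  also have "\<dots> \<le> exp (h * ?p + h\<^sup>2 / 8) ^ k * real (card ?K)"
    using h by (intro mult_right_mono power_mono bernoulli_mgf_le) auto
  also have "\<dots> = exp (real k * (h * ?p + h\<^sup>2 / 8)) * real (card ?K)"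
    by (simp add: exp_of_nat_mult)
  finally have "real (card (?K \<inter> ?E)) / real (card ?K)
      \<le> exp (real k * (h * ?p + h\<^sup>2 / 8)) / exp (h * (real k * r))"
    using K0 by (simp add: field_simps)
  also have "\<dots> = exp (real k * (h * ?p + h\<^sup>2 / 8) - h * (real k * r))"
    by (simp add: exp_diff)
  \<comment> \<open>With \<open>d = r - ?p\<close>, the terms linear in \<open>h\<close> contribute
    \<open>- 4 * k * d\<^sup>2\<close> and the quadratic one
    \<open>2 * k * d\<^sup>2\<close>.\<close>
  also have "real k * (h * ?p + h\<^sup>2 / 8) - h * (real k * r) = - 2 * real k * (?p - r)\<^sup>2"
    unfolding h_def by (simp only: power2_eq_square) algebra
  finally show ?thesis
    using measure_pmf_of_set[OF nK fK] by simp
qed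

section \<open>From one pair to the maximum over all pairs\<close>

text \<open>By independence, coordinate \<open>j\<close> can be drawn after all the others. The
  bound then holds for each possible value of coordinate \<open>i\<close>, and averaging over the
  other coordinates preserves it.\<close>

lemma prob_Pi_pmf_pair_le:
  fixes c :: real
  assumes "finite I" "i \<in> I" "j \<in> I" "i \<noteq> j" "0 \<le> c"
    and le: "\<And>x. x \<in> set_pmf (p i) \<Longrightarrow> measure_pmf.prob (p j) {y. Q x y} \<le> c"
  shows "measure_pmf.prob (Pi_pmf I d p) {f. Q (f i) (f j)} \<le> c"
proof -
  let ?P = "Pi_pmf (I - {j}) d p"
  have "Pi_pmf I d p = map_pmf (\<lambda>(y, f). f(j := y)) (pair_pmf (p j) ?P)"
    using Pi_pmf_insert[of "I - {j}" j d p] assms by (simp add: insert_absorb)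
  also have "\<dots> = bind_pmf ?P (\<lambda>f. map_pmf (\<lambda>y. f(j := y)) (p j))"
    by (subst pair_commute_pmf)
      (simp add: pair_pmf_def map_pmf_def bind_assoc_pmf bind_return_pmf case_prod_unfold)
  finally have "emeasure (Pi_pmf I d p) {f. Q (f i) (f j)}
      = (\<integral>\<^sup>+f. emeasure (p j) {y. Q (f i) y} \<partial>?P)"
    using assms by (simp add: vimage_def)
  also have "\<dots> \<le> (\<integral>\<^sup>+f. ennreal c \<partial>?P)"
  proof (intro nn_integral_mono_AE)
    have "f i \<in> set_pmf (p i)" if "f \<in> set_pmf ?P" for f
      using that assms set_Pi_pmf[of "I - {j}" d p] by (auto simp: PiE_dflt_def)
    then show "AE f in ?P. emeasure (p j) {y. Q (f i) y} \<le> ennreal c"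
      using le by (auto simp: AE_measure_pmf_iff measure_pmf.emeasure_eq_measure intro!: ennreal_leI)
  qed
  also have "\<dots> = ennreal c"
    by simp
  finally show ?thesis
    using assms by (simp add: measure_pmf.emeasure_eq_measure)
qed

lemma overlap_prob_le:
  fixes r :: real
  assumes "finite D" "k \<le> card D" "0 < k" "0 < r" "real k / real (card D) \<le> r"
  shows "overlap_prob D k r A
    \<le> (real A)\<^sup>2 / 2 * exp (- 2 * real k * (real k / real (card D) - r)\<^sup>2)"
proof -
  let ?q = "exp (- 2 * real k * (real k / real (card D) - r)\<^sup>2)"
  let ?E = "\<lambda>(i, j). {X :: nat \<Rightarrow> 'a set. real k * r \<le> real (card (X i \<inter> X j))}"
  \<comment> \<open>The larger index comes first, so that the fibre over \<open>j\<close> has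
    \<open>j - 1\<close> elements and \<open>P\<close> has \<open>A * (A - 1) / 2\<close>.\<close>
  define P where "P = Sigma {1..A} (\<lambda>j. {1..<j})"
  have fP: "finite P"
    by (simp add: P_def)
  have "2 * (\<Sum>j=1..A. real j - 1) \<le> (real A)\<^sup>2"
    by (induction A) (auto simp: algebra_simps power2_eq_square)
  moreover have "real (card P) = (\<Sum>j=1..A. real j - 1)"
    by (simp add: P_def of_nat_diff)
  ultimately have cP: "real (card P) \<le> (real A)\<^sup>2 / 2"
    by simp
  \<comment> \<open>A positive threshold excludes the value 0 inserted into the maximum, so the
    maximum is attained by a genuine pair.\<close>
  have kr: "0 < real k * r"
    using assms by simp
  have "{X. real k * r \<le> real (max_overlap A X)} \<subseteq> (\<Union>z\<in>P. ?E z)"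
  proof
    fix X :: "nat \<Rightarrow> 'a set"
    let ?O = "{card (X i \<inter> X j) | i j. 1 \<le> i \<and> i < j \<and> j \<le> A}"
    assume X: "X \<in> {X. real k * r \<le> real (max_overlap A X)}"
    have "max_overlap A X \<in> insert 0 ?O"
      unfolding max_overlap_def by (rule Max_in) (use finite_overlaps in auto)
    moreover have "max_overlap A X \<noteq> 0"
      using X kr by auto
    ultimately obtain i j where "max_overlap A X = card (X i \<inter> X j)" "1 \<le> i" "i < j" "j \<le> A"
      by blast
    then have "(j, i) \<in> P" "X \<in> ?E (j, i)"
      using X by (auto simp: P_def Int_commute)
    then show "X \<in> (\<Union>z\<in>P. ?E z)"
      by blast
  qed
  then have "overlap_prob D k r A \<le> measure_pmf.prob (subsamples D k A) (\<Union>z\<in>P. ?E z)"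
    unfolding overlap_prob_def by (intro measure_pmf.finite_measure_mono) auto
  also have "\<dots> \<le> (\<Sum>z\<in>P. measure_pmf.prob (subsamples D k A) (?E z))"
    by (intro measure_pmf.finite_measure_subadditive_finite fP) auto
  also have "\<dots> \<le> (\<Sum>z\<in>P. ?q)"
  proof (rule sum_mono)
    fix z assume "z \<in> P"
    then obtain i j where z: "z = (i, j)" "i \<in> {1..A}" "j \<in> {1..A}" "i \<noteq> j"
      by (auto simp: P_def)
    have "measure_pmf.prob (subsamples D k A) {X. real k * r \<le> real (card (X i \<inter> X j))} \<le> ?q"
      unfolding subsamples_def
    proof (rule prob_Pi_pmf_pair_le)
      fix T assume "T \<in> set_pmf (pmf_of_set (k_subsets D k))"
      then have "T \<in> k_subsets D k"
        using assms by (simp add: finite_k_subsets k_subsets_nonempty)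
      then show "measure_pmf.prob (pmf_of_set (k_subsets D k))
          {X. real k * r \<le> real (card (T \<inter> X))} \<le> ?q"
        using assms by (intro prob_inter_k_subset_ge) auto
    qed (use z in auto)
    then show "measure_pmf.prob (subsamples D k A) (?E z) \<le> ?q"
      using z by simp
  qed
  also have "\<dots> = real (card P) * ?q"
    by simp
  also have "\<dots> \<le> (real A)\<^sup>2 / 2 * ?q"
    using cP by (rule mult_right_mono) simp
  finally show ?thesis .
qed

text \<open>The floor appears because \<open>C\<^sub>0\<close> is a natural number and the union
  bound is applied at a natural number \<open>A\<close>.\<close>

theorem corollary15:
  fixes D :: "'a set" and n k :: nat and l r\<^sub>1 r\<^sub>2 p_tol :: real
  assumes "finite D" and "card D = n"
    and "1 \<le> k" and "k \<le> n"
    and "r\<^sub>1 = real k / real n" and "r\<^sub>2 = l / real k"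
    and "r\<^sub>2 \<in> {real k / real n..1}"
    and "0 \<le> p_tol" and "p_tol < 1"
  shows "int (C\<^sub>0 D k r\<^sub>2 p_tol) \<ge> \<lfloor>sqrt (2 * p_tol) * exp (real k * \<bar>r\<^sub>1 - r\<^sub>2\<bar>^2)\<rfloor>"
proof -
  let ?d = "real k * (r\<^sub>1 - r\<^sub>2)\<^sup>2"
  let ?b = "sqrt (2 * p_tol) * exp ?d"
  \<comment> \<open>The largest natural number for which the union bound
    \<open>A\<^sup>2 / 2 * exp (- 2 * ?d)\<close> is at most \<open>p_tol\<close>. Solving for
    \<open>A\<close> takes a square root, which turns the exponent \<open>2 * ?d\<close> into
    \<open>?d\<close>.\<close>
  define A where "A = nat \<lfloor>?b\<rfloor>"
  have b0: "0 \<le> ?b"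
    using assms by simp
  have n: "0 < n"
    using assms by simp
  have "0 < real k / real n"
    using assms n by simp
  then have r2: "0 < r\<^sub>2"
    using assms(7) by auto
  have "real A \<le> ?b"
    using b0 by (simp add: A_def)
  then have "(real A)\<^sup>2 \<le> ?b\<^sup>2"
    by (intro power_mono) auto
  also have "\<dots> = 2 * p_tol * exp (2 * ?d)"
    using assms by (simp add: power_mult_distrib exp_double)
  finally have A2: "(real A)\<^sup>2 / 2 \<le> p_tol * exp (2 * ?d)"
    by simp
  have "overlap_prob D k r\<^sub>2 A \<le> (real A)\<^sup>2 / 2 * exp (- 2 * real k * (r\<^sub>1 - r\<^sub>2)\<^sup>2)"
    using overlap_prob_le[of D k r\<^sub>2 A] assms r2 by simp
  also have "\<dots> \<le> p_tol * exp (2 * ?d) * exp (- 2 * real k * (r\<^sub>1 - r\<^sub>2)\<^sup>2)"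
    using A2 by (rule mult_right_mono) simp
  also have "\<dots> = p_tol"
    by (simp add: mult.assoc flip: exp_add)
  finally have "A \<le> C\<^sub>0 D k r\<^sub>2 p_tol"
    using assms r2 by (intro C\<^sub>0_greatest(2)) auto
  then show ?thesis
    using b0 by (simp add: A_def nat_le_iff)
qed

end
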